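(* Let $X^*$ be a solution of $$\mathbf{A}(X)=y,\quad X\in\mathcal{M}_{k,s},$$ with exactly $s$ nonzero rows, and assume $\operatorname{rank}(X^* )=\min(k,s)$. Let $S^*\subseteq\{1,\dots,M\}$, $|S^*|=s$, be the row support of $X^*$. Assume the spectral norm of $\mathbf{I}-\mathbf{A}^*\mathbf{A}$ on the tangent space $T_{X^*}\mathcal{M}_{k,S^*}$ is $\delta<1$. Then there exists an $\epsilon>0$ such that if a sequence $(X_\ell)$ generated, from a starting point $X_0\in\mathcal{M}_{k,s}$, by the iteration $$X_{\ell+1}=(\mathbf{T}_k\circ\mathbf{H}_s)\bigl(X_\ell-\mathbf{A}^*(\mathbf{A}(X_\ell)-y)\bigr),\qquad\ell=0,1,\dots,$$ satisfies $\|X_\ell-X^*\|_F\le\epsilon$ for some $\ell$, then $X_\ell$ converges to $X^*$ and $$\limsup_{\ell\to\infty}\frac{\|X_{\ell+1}-X^*\|_F}{\|X_\ell-X^*\|_F}\le\delta.$$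
   Context: $M,N,m,k,s$ are positive integers with $k<s$. $\mathbf{A}:\mathbb{R}^{M\times N}\to\mathbb{R}^m$ is a linear operator, $\mathbf{A}^*$ its adjoint with respect to the Frobenius and Euclidean inner products, $y\in\mathbb{R}^m$, and $\mathbf{I}$ is the identity on $\mathbb{R}^{M\times N}$. $\|X\|_0$ denotes the number of nonzero rows of $X$, and $\mathcal{M}_{k,s}=\{X\in\mathbb{R}^{M\times N}:\operatorname{rank}(X)\le k,\ \|X\|_0\le s\}$. $\mathcal{M}_{k,S^*}$ denotes the variety of matrices in $\mathbb{R}^{M\times N}$ of rank at most $k$ whose nonzero rows all have indices in $S^*$; under the rank assumption on $X^*$ it is a smooth manifold around $X^*$, and $T_{X^*}\mathcal{M}_{k,S^*}$ is its tangent space at $X^*$. The spectral norm of $\mathbf{I}-\mathbf{A}^*\mathbf{A}$ on a linear subspace $T\subseteq\mathbb{R}^{M\times N}$ is the operator norm (with respect to the Frobenius norm) of $\mathbf{P}_T(\mathbf{I}-\mathbf{A}^*\mathbf{A})\mathbf{P}_T$, where $\mathbf{P}_T$ is the orthogonal projection onto $T$. $\mathbf{H}_s(X)=X_S$, where $S\subseteq\{1,\dots,M\}$ contains the indices of $s$ rows of $X$ with largest Euclidean norm, and $X_S$ denotes $X$ with all rows not in $S$ set to zero. $\mathbf{T}_k(X)$ is a best approximation of $X$ in Frobenius norm by matrices of rank at most $k$. If these are not unique, some specific (arbitrary) selection rule is applied. The iteration is iterative hard thresholding with quasi-optimal projection and fixed step size $1$. In the quotient, $0/0$ is read as $0$.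 *)

theory Defs
  imports "HOL-Analysis.Analysis"
begin

text \<open>
  An \<open>M \<times> N\<close> matrix is an element of \<^typ>\<open>real ^ 'n ^ 'm\<close> (rows indexed by \<open>'m\<close>,
  \<open>M = CARD('m)\<close>, \<open>N = CARD('n)\<close>). On this type the library's inner product and norm are the
  Frobenius ones, so \<^const>\<open>adjoint\<close>, \<^const>\<open>norm\<close> and \<^const>\<open>onorm\<close> have the intended meaning.
\<close>

definition row_support :: "real ^ 'n ^ 'm \<Rightarrow> 'm set" where
  "row_support X = {i. row i X \<noteq> 0}"

definition row_norm0 :: "real ^ 'n ^ 'm \<Rightarrow> nat" where
  "row_norm0 X = card (row_support X)"

definition rank_row_sparse :: "nat \<Rightarrow> nat \<Rightarrow> (real ^ 'n ^ 'm) set" where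
  "rank_row_sparse k s = {X. rank X \<le> k \<and> row_norm0 X \<le> s}"

definition rank_row_supported :: "nat \<Rightarrow> 'm set \<Rightarrow> (real ^ 'n ^ 'm) set" where
  "rank_row_supported k S = {X. rank X \<le> k \<and> row_support X \<subseteq> S}"

text \<open>\<open>D n\<close> is the \<open>n\<close>-th derivative of the curve on the open interval \<open>I\<close>.\<close>

definition smooth_curve_on :: "real set \<Rightarrow> (real \<Rightarrow> 'a::real_normed_vector) \<Rightarrow> bool" where
  "smooth_curve_on I c \<longleftrightarrow>
    (\<exists>D. D 0 = c \<and> (\<forall>n. \<forall>t\<in>I. (D n has_vector_derivative D (Suc n) t) (at t)))"

text \<open>
  Velocities at \<open>x\<close> of smooth curves in \<open>V\<close>. This is the tangent space of \<open>V\<close> at \<open>x\<close> whenever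
  \<open>V\<close> is a smooth embedded submanifold in a neighbourhood of \<open>x\<close>; at other points it need not
  be a linear subspace.
\<close>

definition tangent_space :: "'a::real_normed_vector set \<Rightarrow> 'a \<Rightarrow> 'a set" where
  "tangent_space V x =
    {v. \<exists>c e. e > 0 \<and> smooth_curve_on {-e<..<e} c \<and> c ` {-e<..<e} \<subseteq> V \<and>
          c 0 = x \<and> (c has_vector_derivative v) (at 0)}"

text \<open>Orthogonal projection; well defined when \<open>T\<close> is a finite-dimensional linear subspace.\<close>

definition orth_proj :: "'a::real_inner set \<Rightarrow> 'a \<Rightarrow> 'a" where
  "orth_proj T x = (THE p. p \<in> T \<and> (\<forall>v\<in>T. orthogonal (x - p) v))"

definition spectral_norm_on :: "'a::real_inner set \<Rightarrow> ('a \<Rightarrow> 'a) \<Rightarrow> real" where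
  "spectral_norm_on T B = onorm (orth_proj T \<circ> B \<circ> orth_proj T)"

definition restrict_rows :: "'m set \<Rightarrow> real ^ 'n ^ 'm \<Rightarrow> real ^ 'n ^ 'm" where
  "restrict_rows S X = (\<chi> i. if i \<in> S then row i X else 0)"

text \<open>
  The next two predicates characterize the admissible operators \<open>H\<^sub>s\<close> and \<open>T\<^sub>k\<close>: where the index set
  or the best approximation is not unique, the function embodies an arbitrary selection rule.
\<close>

definition is_row_threshold :: "nat \<Rightarrow> (real ^ 'n ^ 'm \<Rightarrow> real ^ 'n ^ 'm) \<Rightarrow> bool" where
  "is_row_threshold s H \<longleftrightarrow>
    (\<forall>X. \<exists>S. card S = s \<and> (\<forall>i\<in>S. \<forall>j. j \<notin> S \<longrightarrow> norm (row j X) \<le> norm (row i X)) \<and>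
         H X = restrict_rows S X)"

definition is_rank_truncation :: "nat \<Rightarrow> (real ^ 'n ^ 'm \<Rightarrow> real ^ 'n ^ 'm) \<Rightarrow> bool" where
  "is_rank_truncation k T \<longleftrightarrow>
    (\<forall>X. rank (T X) \<le> k \<and> (\<forall>Y. rank Y \<le> k \<longrightarrow> norm (X - T X) \<le> norm (X - Y)))"

end

theory Submission
  imports Defs
begin

text \<open>
  The iteration map is differentiable at \<open>Xstar\<close>, and its derivative, restricted to the directions
  in which the iterates can approach \<open>Xstar\<close>, is the compression of \<open>B X = X - adjoint A (A X)\<close> to the
  tangent space \<open>U\<close> of \<open>rank_row_supported k Sstar\<close> at \<open>Xstar\<close>. The norm of this compression is \<open>\<delta>\<close>.
  Since \<open>\<delta> < 1\<close>, the map contracts near \<open>Xstar\<close> with factors arbitrarily close to \<open>\<delta>\<close>, which yields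
  both convergence and the rate (\<open>locally_contracting_iteration_converges\<close>).

  In detail, write \<open>E = X - Xstar\<close> for an iterate \<open>X\<close> near \<open>Xstar\<close>. Because \<open>Xstar\<close> uses its full budget
  of \<open>s\<close> nonzero rows, \<open>X\<close> has the same row support, and row thresholding near \<open>Xstar\<close> always selects
  exactly these rows; both operators thus act on the fixed variety \<open>rank_row_supported k Sstar\<close>.
  Because \<open>Xstar\<close> has the maximal rank \<open>k\<close>, the variety is tangent to \<open>U\<close> to first order. Consequently
  \<open>E = orth_proj U E + o(norm E)\<close>; the gradient step turns \<open>E\<close> into \<open>B E\<close>; and rank truncation,
  being a nearest-point map onto the variety, acts as \<open>orth_proj U\<close> up to \<open>o(norm E)\<close>
  (\<open>nearest_point_first_order\<close>). The next error is therefore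
  \<open>orth_proj U (B (orth_proj U E)) + o(norm E)\<close>.

  The analytic part needs of the variety only the two-sided approximation by a linear subspace that
  is expressed by \<open>first_order_tangent\<close>. It is verified for matrices of bounded rank by matrix algebra
  with a generalized inverse of \<open>Xstar\<close> (\<open>rank_row_supported_first_order_tangent\<close>), and the same
  computation identifies the velocities of smooth curves (\<open>tangent_space_rank_row_supported\<close>).
\<close>

section \<open>Orthogonal projection onto a subspace\<close>

lemma orth_proj_eqI:
  assumes "subspace T" "p \<in> T" "\<And>v. v \<in> T \<Longrightarrow> orthogonal (x - p) v"
  shows "orth_proj T x = p"
  unfolding orth_proj_def
proof (rule the_equality)
  show "p \<in> T \<and> (\<forall>v\<in>T. orthogonal (x - p) v)"
    using assms by blast
next
  fix q assume q: "q \<in> T \<and> (\<forall>v\<in>T. orthogonal (x - q) v)"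
  have "p - q \<in> T"
    using assms q subspace_diff by blast
  then have "(x - p) \<bullet> (p - q) = 0" "(x - q) \<bullet> (p - q) = 0"
    using assms(3) q unfolding orthogonal_def by blast+
  then have "(p - q) \<bullet> (p - q) = 0"
    by (simp add: inner_diff_left)
  then show "q = p" by simp
qed

lemma
  fixes T :: "'a::euclidean_space set"
  assumes "subspace T"
  shows orth_proj_in: "orth_proj T x \<in> T"
    and orth_proj_orthogonal: "v \<in> T \<Longrightarrow> orthogonal (x - orth_proj T x) v"
proof -
  obtain p n where p: "p \<in> span T" "\<And>w. w \<in> span T \<Longrightarrow> orthogonal n w" "x = p + n"
    using orthogonal_subspace_decomp_exists[of T x] by blast
  have sp: "span T = T" using assms by simp
  have "orth_proj T x = p"
    by (rule orth_proj_eqI[OF assms]) (use p sp in auto)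
  then show "orth_proj T x \<in> T" "v \<in> T \<Longrightarrow> orthogonal (x - orth_proj T x) v"
    using p sp by auto
qed

lemma linear_orth_proj:
  fixes T :: "'a::euclidean_space set"
  assumes "subspace T"
  shows "linear (orth_proj T)"
proof (rule linearI)
  fix x y
  show "orth_proj T (x + y) = orth_proj T x + orth_proj T y"
  proof (rule orth_proj_eqI[OF assms])
    show "orth_proj T x + orth_proj T y \<in> T"
      by (intro subspace_add assms orth_proj_in)
    fix v assume v: "v \<in> T"
    show "orthogonal (x + y - (orth_proj T x + orth_proj T y)) v"
      using orth_proj_orthogonal[OF assms v, of x] orth_proj_orthogonal[OF assms v, of y]
      by (simp add: orthogonal_def inner_add_left inner_diff_left)
  qed
next
  fix c :: real and x
  show "orth_proj T (c *\<^sub>R x) = c *\<^sub>R orth_proj T x"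
  proof (rule orth_proj_eqI[OF assms])
    show "c *\<^sub>R orth_proj T x \<in> T"
      by (intro subspace_scale assms orth_proj_in)
    fix v assume v: "v \<in> T"
    show "orthogonal (c *\<^sub>R x - c *\<^sub>R orth_proj T x) v"
      using orth_proj_orthogonal[OF assms v, of x]
      by (simp add: orthogonal_def inner_diff_left)
  qed
qed

lemma orth_proj_pythagoras:
  fixes T :: "'a::euclidean_space set"
  assumes "subspace T" "w \<in> T"
  shows "(norm (x - w))\<^sup>2 = (norm (x - orth_proj T x))\<^sup>2 + (norm (orth_proj T x - w))\<^sup>2"
proof -
  have "orth_proj T x - w \<in> T"
    by (intro subspace_diff assms orth_proj_in)
  then have "orthogonal (x - orth_proj T x) (orth_proj T x - w)"
    using orth_proj_orthogonal assms(1) by blast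
  from norm_add_Pythagorean[OF this] show ?thesis by simp
qed

lemma
  fixes T :: "'a::euclidean_space set"
  assumes "subspace T"
  shows norm_orth_proj_le: "norm (orth_proj T x) \<le> norm x"
    and norm_minus_orth_proj_le: "norm (x - orth_proj T x) \<le> norm x"
proof -
  have "(norm x)\<^sup>2 = (norm (x - orth_proj T x))\<^sup>2 + (norm (orth_proj T x))\<^sup>2"
    using orth_proj_pythagoras[OF assms subspace_0[OF assms], of x] by simp
  then have "(norm (orth_proj T x))\<^sup>2 \<le> (norm x)\<^sup>2" "(norm (x - orth_proj T x))\<^sup>2 \<le> (norm x)\<^sup>2"
    by simp_all
  then show "norm (orth_proj T x) \<le> norm x" "norm (x - orth_proj T x) \<le> norm x"
    using power2_le_imp_le norm_ge_zero by blast+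
qed

section \<open>Sets with a linear first-order approximation\<close>

text \<open>
  A substitute for smoothness of \<open>V\<close> at \<open>x\<close>. The first clause says that displacements inside
  \<open>V\<close> have almost no component transversal to \<open>T\<close>; the second that \<open>V\<close> leaves no direction of \<open>T\<close>
  out, uniformly in the direction. A smooth submanifold has both properties with its tangent space
  as \<open>T\<close>.
\<close>

definition first_order_tangent ::
    "'a::real_normed_vector set \<Rightarrow> 'a \<Rightarrow> 'a set \<Rightarrow> bool" where
  "first_order_tangent V x T \<longleftrightarrow>
    (\<forall>\<eta>>0. \<exists>r>0. \<forall>z\<in>V. norm (z - x) \<le> r \<longrightarrow> (\<exists>v\<in>T. norm (z - x - v) \<le> \<eta> * norm (z - x))) \<and>
    (\<forall>\<eta>>0. \<exists>r>0. \<forall>v\<in>T. norm v \<le> r \<longrightarrow> (\<exists>z\<in>V. norm (z - x - v) \<le> \<eta> * norm v))"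

lemma first_order_tangentD1:
  assumes "first_order_tangent V x T" "\<eta> > 0"
  obtains r where "r > 0"
    "\<And>z. z \<in> V \<Longrightarrow> norm (z - x) \<le> r \<Longrightarrow> \<exists>v\<in>T. norm (z - x - v) \<le> \<eta> * norm (z - x)"
  using assms unfolding first_order_tangent_def by meson

lemma first_order_tangentD2:
  assumes "first_order_tangent V x T" "\<eta> > 0"
  obtains r where "r > 0"
    "\<And>v. v \<in> T \<Longrightarrow> norm v \<le> r \<Longrightarrow> \<exists>z\<in>V. norm (z - x - v) \<le> \<eta> * norm v"
  using assms unfolding first_order_tangent_def by meson

text \<open>
  A difference quotient of a curve in \<open>V\<close> has distance \<open>o(1)\<close> from \<open>T\<close>, so its limit lies in
  \<open>closure T = T\<close>.
\<close>

lemma tangent_space_subset: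
  fixes T :: "'a::euclidean_space set"
  assumes T: "subspace T" and V: "first_order_tangent V x T"
  shows "tangent_space V x \<subseteq> T"
proof
  fix v assume "v \<in> tangent_space V x"
  then obtain c e where e: "e > 0" and c: "c ` {-e<..<e} \<subseteq> V" "c 0 = x"
    and c': "(c has_vector_derivative v) (at 0)"
    unfolding tangent_space_def by blast
  have "v \<in> closure T"
    unfolding closure_approachable
  proof (intro allI impI)
    fix \<epsilon> :: real assume "\<epsilon> > 0"
    \<comment> \<open>The errors below add up to \<open>\<eta> * (2 + norm v)\<close>; the \<open>3\<close> makes the final estimate strict.\<close>
    define \<eta> where "\<eta> = min 1 (\<epsilon> / (3 + norm v))"
    have \<eta>: "\<eta> > 0" "\<eta> \<le> 1" "\<eta> * (2 + norm v) < \<epsilon>"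
    proof -
      have pos: "3 + norm v > 0" by (simp add: add_pos_nonneg)
      then show "\<eta> > 0" "\<eta> \<le> 1" using \<open>\<epsilon> > 0\<close> by (auto simp: \<eta>_def)
      have "\<eta> \<le> \<epsilon> / (3 + norm v)" by (simp add: \<eta>_def)
      then have "\<eta> * (3 + norm v) \<le> \<epsilon>" using pos by (simp add: field_simps)
      then show "\<eta> * (2 + norm v) < \<epsilon>" using \<open>\<eta> > 0\<close> by (simp add: algebra_simps)
    qed
    obtain r where r: "r > 0"
      "\<And>z. z \<in> V \<Longrightarrow> norm (z - x) \<le> r \<Longrightarrow> \<exists>v\<in>T. norm (z - x - v) \<le> \<eta> * norm (z - x)"
      using first_order_tangentD1[OF V \<eta>(1)] by blast
    obtain d where d: "d > 0"
      "\<And>h. \<bar>h\<bar> < d \<Longrightarrow> norm (c h - x - h *\<^sub>R v) \<le> \<eta> * \<bar>h\<bar>"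
      using c' \<eta>(1) c(2) unfolding has_vector_derivative_def has_derivative_at_alt
      by (auto simp: real_norm_def)
    \<comment> \<open>\<open>h\<close> is small enough for the derivative estimate, for the domain of the curve, and for
      \<open>norm (c h - x) \<le> r\<close>.\<close>
    define h where "h = min (min (d / 2) (e / 2)) (r / (1 + norm v))"
    have nv: "1 + norm v > 0" by (simp add: add_pos_nonneg)
    have h: "h > 0" "h < d" "h < e" "h \<le> r / (1 + norm v)"
      using e d(1) r(1) nv by (auto simp: h_def)
    have hr: "h * (1 + norm v) \<le> r" using h(4) nv by (simp add: field_simps)
    have der: "norm (c h - x - h *\<^sub>R v) \<le> \<eta> * h" using d(2)[of h] h by simp
    have "norm (c h - x) \<le> norm (c h - x - h *\<^sub>R v) + norm (h *\<^sub>R v)"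
      using norm_triangle_ineq[of "c h - x - h *\<^sub>R v" "h *\<^sub>R v"] by simp
    also have "\<dots> \<le> 1 * h + h * norm v"
    proof -
      have "\<eta> * h \<le> 1 * h" using \<eta>(2) h(1) by (intro mult_right_mono) auto
      moreover have "norm (h *\<^sub>R v) = h * norm v" using h(1) by simp
      ultimately show ?thesis using der by linarith
    qed
    finally have size: "norm (c h - x) \<le> h * (1 + norm v)" by (simp add: algebra_simps)
    have "c h \<in> V" using c(1) h by auto
    then obtain w where w: "w \<in> T" "norm (c h - x - w) \<le> \<eta> * norm (c h - x)"
      using r(2) size hr by (meson order_trans)
    have "norm (w - h *\<^sub>R v) \<le> norm (c h - x - h *\<^sub>R v) + norm (c h - x - w)"
      using norm_triangle_ineq4[of "c h - x - h *\<^sub>R v" "c h - x - w"] by simp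
    also have "\<dots> \<le> \<eta> * h + \<eta> * (h * (1 + norm v))"
      using der w(2) size mult_left_mono[OF size, of \<eta>] \<eta>(1) by linarith
    also have "\<dots> = h * (\<eta> * (2 + norm v))" by (simp add: algebra_simps)
    also have "\<dots> < h * \<epsilon>" using \<eta>(3) h(1) by simp
    finally have *: "norm (w - h *\<^sub>R v) < h * \<epsilon>" .
    have "(1 / h) *\<^sub>R w - v = (1 / h) *\<^sub>R (w - h *\<^sub>R v)"
      using h(1) by (simp add: scaleR_diff_right)
    then have "norm ((1 / h) *\<^sub>R w - v) = norm (w - h *\<^sub>R v) / h"
      using h(1) by simp
    also have "\<dots> < \<epsilon>" using * h(1) by (simp add: field_simps)
    finally have "dist ((1 / h) *\<^sub>R w) v < \<epsilon>" by (simp add: dist_norm)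
    moreover have "(1 / h) *\<^sub>R w \<in> T" using subspace_scale[OF T w(1)] .
    ultimately show "\<exists>y\<in>T. dist y v < \<epsilon>" by blast
  qed
  then show "v \<in> T" using closed_subspace[OF T] by simp
qed

text \<open>
  The nearest-point map onto \<open>V\<close> has the derivative \<open>orth_proj T\<close> at \<open>x\<close>, whatever nearest
  points are selected. Put \<open>e = z - x\<close>, \<open>d = p - x\<close> and \<open>v = orth_proj T e\<close>. Some \<open>q \<in> V\<close> has
  \<open>q - x = v\<close> up to \<open>o(norm e)\<close>, so optimality of \<open>p\<close> gives \<open>norm (e - d) \<le> norm (e - v) + o(norm e)\<close>; and \<open>d\<close> is
  \<open>o(norm e)\<close>-close to some \<open>w \<in> T\<close>. The Pythagorean identity for \<open>e - w\<close> then leaves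
  \<open>(norm (v - w))\<^sup>2 = o((norm e)\<^sup>2)\<close>. The square root taken here is the reason for working with the
  tolerance \<open>t\<^sup>2\<close> in order to reach a final error of order \<open>t\<close>.
\<close>

lemma nearest_point_first_order:
  fixes T :: "'a::euclidean_space set"
  assumes T: "subspace T" and V: "first_order_tangent V x T" and xV: "x \<in> V" and "\<eta> > 0"
  obtains r where "r > 0"
    "\<And>z p. norm (z - x) \<le> r \<Longrightarrow> p \<in> V \<Longrightarrow> (\<And>q. q \<in> V \<Longrightarrow> norm (z - p) \<le> norm (z - q)) \<Longrightarrow>
       norm (p - x - orth_proj T (z - x)) \<le> \<eta> * norm (z - x)"
proof -
  \<comment> \<open>The final error is at most \<open>2 * t\<^sup>2 + 4 * t \<le> 6 * t\<close> times \<open>norm (z - x)\<close>.\<close>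
  define t where "t = min 1 (\<eta> / 6)"
  have t: "t > 0" "t \<le> 1" "6 * t \<le> \<eta>" using \<open>\<eta> > 0\<close> by (auto simp: t_def)
  have t2: "t\<^sup>2 > 0" "t\<^sup>2 \<le> t" using t by (auto simp: power2_eq_square mult_left_le)
  obtain r1 where r1: "r1 > 0"
    "\<And>z. z \<in> V \<Longrightarrow> norm (z - x) \<le> r1 \<Longrightarrow> \<exists>v\<in>T. norm (z - x - v) \<le> t\<^sup>2 * norm (z - x)"
    using first_order_tangentD1[OF V t2(1)] by blast
  obtain r2 where r2: "r2 > 0"
    "\<And>v. v \<in> T \<Longrightarrow> norm v \<le> r2 \<Longrightarrow> \<exists>z\<in>V. norm (z - x - v) \<le> t\<^sup>2 * norm v"
    using first_order_tangentD2[OF V t2(1)] by blast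
  show ?thesis
  proof (rule that[of "min (r1 / 2) r2"])
    show "min (r1 / 2) r2 > 0" using r1(1) r2(1) by simp
    fix z p assume z: "norm (z - x) \<le> min (r1 / 2) r2" and p: "p \<in> V"
      and near: "\<And>q. q \<in> V \<Longrightarrow> norm (z - p) \<le> norm (z - q)"
    define e where "e = z - x"
    define d where "d = p - x"
    define v where "v = orth_proj T e"
    define a where "a = norm e"
    have a0: "a \<ge> 0" by (simp add: a_def)
    have ze: "z - p = e - d" "z - x = e" by (simp_all add: e_def d_def)
    have "norm d \<le> norm e + norm (e - d)"
      using norm_triangle_ineq4[of e "e - d"] by simp
    also have "norm (e - d) \<le> norm e"
      using near[OF xV] ze by simp
    finally have d: "norm d \<le> 2 * a" by (simp add: a_def)
    then have "norm (p - x) \<le> r1" using z by (simp add: a_def d_def e_def)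
    then obtain w where w: "w \<in> T" "norm (d - w) \<le> t\<^sup>2 * norm d"
      using r1(2)[OF p] unfolding d_def by blast
    have dw: "norm (d - w) \<le> 2 * t\<^sup>2 * a"
      using w(2) mult_left_mono[OF d, of "t\<^sup>2"] by simp
    have vT: "v \<in> T" unfolding v_def by (rule orth_proj_in[OF T])
    have va: "norm v \<le> a" unfolding v_def a_def by (rule norm_orth_proj_le[OF T])
    then have "norm v \<le> r2" using z by (simp add: a_def e_def)
    then obtain q where q: "q \<in> V" "norm (q - x - v) \<le> t\<^sup>2 * norm v"
      using r2(2)[OF vT] by blast
    have qv: "norm (q - x - v) \<le> t\<^sup>2 * a"
      using q(2) mult_left_mono[OF va, of "t\<^sup>2"] by simp
    define n where "n = norm (e - v)"
    have n: "0 \<le> n" "n \<le> a"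
      unfolding n_def a_def v_def using norm_minus_orth_proj_le[OF T] by auto
    have "norm (e - d) \<le> norm (z - q)" using near[OF q(1)] ze by simp
    also have "z - q = (e - v) - (q - x - v)" by (simp add: e_def)
    also have "norm \<dots> \<le> n + t\<^sup>2 * a"
      using norm_triangle_ineq4[of "e - v" "q - x - v"] qv by (simp add: n_def)
    finally have ed: "norm (e - d) \<le> n + t\<^sup>2 * a" .
    have "norm (e - w) \<le> norm (e - d) + norm (d - w)"
      using norm_triangle_ineq[of "e - d" "d - w"] by simp
    then have ew: "norm (e - w) \<le> n + 3 * (t\<^sup>2 * a)" using ed dw by simp
    have ta: "t\<^sup>2 * a \<ge> 0" using a0 by simp
    have "n\<^sup>2 + (norm (v - w))\<^sup>2 = (norm (e - w))\<^sup>2"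
      using orth_proj_pythagoras[OF T w(1), of e] by (simp add: n_def v_def)
    also have "\<dots> \<le> (n + 3 * (t\<^sup>2 * a))\<^sup>2"
      using ew by (rule power_mono) simp
    also have "\<dots> = n\<^sup>2 + 6 * (n * (t\<^sup>2 * a)) + 9 * (t\<^sup>2 * a) * (t\<^sup>2 * a)"
      by (simp add: power2_eq_square algebra_simps)
    also have "\<dots> \<le> n\<^sup>2 + 6 * (a * (t\<^sup>2 * a)) + 9 * (t\<^sup>2 * a) * a"
    proof -
      have "n * (t\<^sup>2 * a) \<le> a * (t\<^sup>2 * a)" using n ta by (intro mult_right_mono)
      moreover have "t\<^sup>2 * a \<le> a" using t t2 a0 by (intro mult_left_le_one_le) auto
      then have "(t\<^sup>2 * a) * (t\<^sup>2 * a) \<le> (t\<^sup>2 * a) * a" using ta by (intro mult_left_mono)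
      ultimately show ?thesis by linarith
    qed
    finally have "(norm (v - w))\<^sup>2 \<le> 15 * (t\<^sup>2 * a * a)" by (simp add: algebra_simps)
    also have "\<dots> \<le> (4 * (t * a))\<^sup>2" using a0 by (simp add: power2_eq_square algebra_simps)
    finally have vw: "norm (v - w) \<le> 4 * (t * a)"
      by (rule power2_le_imp_le) (use t(1) a0 in simp)
    have "norm (d - v) \<le> norm (d - w) + norm (v - w)"
      using norm_triangle_ineq4[of "d - w" "v - w"] by simp
    also have "\<dots> \<le> 2 * (t * a) + 4 * (t * a)"
      using dw vw mult_right_mono[OF t2(2) a0] by linarith
    also have "\<dots> \<le> \<eta> * a" using mult_right_mono[OF t(3) a0] by linarith
    finally show "norm (p - x - orth_proj T (z - x)) \<le> \<eta> * norm (z - x)"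
      by (simp add: d_def v_def a_def e_def)
  qed
qed

section \<open>Locally contracting iterations\<close>

text \<open>
  The tolerance \<open>\<eta> = (1 - \<delta>) / 2\<close> makes a whole ball around \<open>x\<close> contract with a factor below \<open>1\<close>, which
  gives convergence; once the iterates converge, they enter the ball belonging to every smaller
  \<open>\<eta>\<close>, which gives the sharp rate.
\<close>

lemma locally_contracting_iteration_converges:
  fixes \<Phi> :: "'a::real_normed_vector \<Rightarrow> 'a"
  assumes \<delta>: "0 \<le> \<delta>" "\<delta> < 1"
    and contr: "\<And>\<eta>. \<eta> > 0 \<Longrightarrow>
      \<exists>r>0. \<forall>z\<in>M. norm (z - x) \<le> r \<longrightarrow> norm (\<Phi> z - x) \<le> (\<delta> + \<eta>) * norm (z - x)"
  shows "\<exists>\<epsilon>>0. \<forall>X. (\<forall>l. X l \<in> M) \<longrightarrow> (\<forall>l. X (Suc l) = \<Phi> (X l)) \<longrightarrow>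
      (\<exists>l. norm (X l - x) \<le> \<epsilon>) \<longrightarrow>
      X \<longlonglongrightarrow> x \<and> limsup (\<lambda>l. ereal (norm (X (Suc l) - x) / norm (X l - x))) \<le> ereal \<delta>"
proof -
  define \<rho> where "\<rho> = \<delta> + (1 - \<delta>) / 2"
  have \<rho>: "0 \<le> \<rho>" "\<rho> < 1" using \<delta> by (auto simp: \<rho>_def field_simps)
  obtain \<epsilon> where \<epsilon>: "\<epsilon> > 0"
    "\<And>z. z \<in> M \<Longrightarrow> norm (z - x) \<le> \<epsilon> \<Longrightarrow> norm (\<Phi> z - x) \<le> \<rho> * norm (z - x)"
    using contr[of "(1 - \<delta>) / 2"] \<delta>(2) unfolding \<rho>_def by auto
  show ?thesis
  proof (intro exI[of _ \<epsilon>] conjI[OF \<epsilon>(1)] allI impI)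
    fix X :: "nat \<Rightarrow> 'a"
    assume M: "\<forall>l. X l \<in> M" and step: "\<forall>l. X (Suc l) = \<Phi> (X l)"
      and "\<exists>l. norm (X l - x) \<le> \<epsilon>"
    then obtain l0 where l0: "norm (X l0 - x) \<le> \<epsilon>" by blast
    have decay: "norm (X (j + l0) - x) \<le> \<rho> ^ j * \<epsilon>" for j
    proof (induction j)
      case 0 then show ?case using l0 by simp
    next
      case (Suc j)
      have "\<rho> ^ j * \<epsilon> \<le> \<epsilon>" using \<rho> \<epsilon>(1) by (simp add: power_le_one)
      then have "norm (X (Suc (j + l0)) - x) \<le> \<rho> * norm (X (j + l0) - x)"
        using \<epsilon>(2) M step Suc by (metis order_trans)
      also have "\<dots> \<le> \<rho> * (\<rho> ^ j * \<epsilon>)" using Suc \<rho>(1) by (rule mult_left_mono)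
      finally show ?case by (simp add: mult.assoc)
    qed
    have "(\<lambda>j. \<rho> ^ j * \<epsilon>) \<longlonglongrightarrow> 0"
      using \<rho> by (intro tendsto_mult_left_zero LIMSEQ_realpow_zero)
    then have "(\<lambda>j. X (j + l0) - x) \<longlonglongrightarrow> 0"
      by (rule Lim_null_comparison[rotated]) (simp add: decay)
    then have lim: "X \<longlonglongrightarrow> x"
      using LIMSEQ_offset[of X l0 x] LIM_zero_iff[of "\<lambda>j. X (j + l0)" x sequentially] by blast
    have "limsup (\<lambda>l. ereal (norm (X (Suc l) - x) / norm (X l - x))) \<le> ereal \<delta> + ereal \<eta>"
      if \<eta>: "\<eta> > 0" for \<eta>
    proof -
      obtain r where r: "r > 0"
        "\<And>z. z \<in> M \<Longrightarrow> norm (z - x) \<le> r \<Longrightarrow> norm (\<Phi> z - x) \<le> (\<delta> + \<eta>) * norm (z - x)"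
        using contr[OF \<eta>] by blast
      have "eventually (\<lambda>l. norm (X l - x) < r) sequentially"
        using tendstoD[OF lim r(1)] by (simp add: dist_norm)
      then have "eventually (\<lambda>l. ereal (norm (X (Suc l) - x) / norm (X l - x)) \<le> ereal (\<delta> + \<eta>))
          sequentially"
      proof eventually_elim
        case (elim l)
        then have "norm (X (Suc l) - x) \<le> (\<delta> + \<eta>) * norm (X l - x)"
          using r(2) M step by simp
        then have "norm (X (Suc l) - x) / norm (X l - x) \<le> \<delta> + \<eta>"
          using \<delta>(1) \<eta> by (cases "norm (X l - x) = 0") (auto simp: field_simps)
        then show ?case by simp
      qed
      then have "limsup (\<lambda>l. ereal (norm (X (Suc l) - x) / norm (X l - x))) \<le> ereal (\<delta> + \<eta>)"
        by (rule Limsup_bounded)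
      then show ?thesis by simp
    qed
    then have "limsup (\<lambda>l. ereal (norm (X (Suc l) - x) / norm (X l - x))) \<le> ereal \<delta>"
      by (rule ereal_le_epsilon2)
    with lim show "X \<longlonglongrightarrow> x \<and>
        limsup (\<lambda>l. ereal (norm (X (Suc l) - x) / norm (X l - x))) \<le> ereal \<delta>" by blast
  qed
qed

section \<open>Matrix products and the Frobenius norm\<close>

lemma bounded_bilinear_matrix_mult:
  "bounded_bilinear ((**) :: real ^ 'n ^ 'm \<Rightarrow> real ^ 'p ^ 'n \<Rightarrow> real ^ 'p ^ 'm)"
  unfolding bilinear_conv_bounded_bilinear[symmetric] bilinear_def
  by (auto simp: linear_iff matrix_matrix_mult_def vec_eq_iff sum.distrib
      distrib_left distrib_right sum_distrib_left mult_ac)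

lemmas matrix_mult_add_left = bounded_bilinear.add_left[OF bounded_bilinear_matrix_mult]
  and matrix_mult_add_right = bounded_bilinear.add_right[OF bounded_bilinear_matrix_mult]
  and matrix_mult_diff_left = bounded_bilinear.diff_left[OF bounded_bilinear_matrix_mult]
  and matrix_mult_diff_right = bounded_bilinear.diff_right[OF bounded_bilinear_matrix_mult]
  and matrix_mult_scaleR_left = bounded_bilinear.scaleR_left[OF bounded_bilinear_matrix_mult]
  and matrix_mult_scaleR_right = bounded_bilinear.scaleR_right[OF bounded_bilinear_matrix_mult]
  and matrix_mult_zero_left = bounded_bilinear.zero_left[OF bounded_bilinear_matrix_mult]
  and matrix_mult_zero_right = bounded_bilinear.zero_right[OF bounded_bilinear_matrix_mult]

lemmas matrix_mult_expand =
  matrix_mult_add_left matrix_mult_add_right matrix_mult_diff_left matrix_mult_diff_right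
  matrix_mult_scaleR_left matrix_mult_scaleR_right matrix_mult_zero_left matrix_mult_zero_right
  matrix_mul_assoc[symmetric]

lemma power2_norm_eq_sum_rows:
  fixes A :: "real ^ 'n ^ 'm"
  shows "(norm A)\<^sup>2 = (\<Sum>i\<in>UNIV. (norm (A $ i))\<^sup>2)"
  by (simp add: power2_norm_eq_inner inner_vec_def)

lemma power2_norm_eq_sum_columns:
  fixes A :: "real ^ 'n ^ 'm"
  shows "(norm A)\<^sup>2 = (\<Sum>j\<in>UNIV. (norm (column j A))\<^sup>2)"
  by (simp add: power2_norm_eq_inner inner_vec_def column_def) (rule sum.swap)

lemma norm_matrix_vector_mult_le:
  fixes A :: "real ^ 'n ^ 'm"
  shows "norm (A *v x) \<le> norm A * norm x"
proof (rule power2_le_imp_le)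
  have "(norm (A *v x))\<^sup>2 = (\<Sum>i\<in>UNIV. (A $ i \<bullet> x)\<^sup>2)"
    unfolding power2_norm_eq_inner inner_vec_def[of "A *v x"] matrix_vector_mul_component
    by (simp add: power2_eq_square)
  also have "\<dots> \<le> (\<Sum>i\<in>UNIV. (norm (A $ i))\<^sup>2 * (norm x)\<^sup>2)"
    using Cauchy_Schwarz_ineq by (intro sum_mono) (simp add: power2_norm_eq_inner)
  also have "\<dots> = (norm A * norm x)\<^sup>2"
    by (simp add: power2_norm_eq_sum_rows[of A] power_mult_distrib sum_distrib_right)
  finally show "(norm (A *v x))\<^sup>2 \<le> (norm A * norm x)\<^sup>2" .
qed simp

lemma column_matrix_mult: "column j (A ** B) = A *v column j B"
  by (simp add: column_def matrix_matrix_mult_def matrix_vector_mult_def vec_eq_iff)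

lemma norm_matrix_mult_le:
  fixes A :: "real ^ 'n ^ 'm" and B :: "real ^ 'p ^ 'n"
  shows "norm (A ** B) \<le> norm A * norm B"
proof (rule power2_le_imp_le)
  have "(norm (A ** B))\<^sup>2 = (\<Sum>j\<in>UNIV. (norm (A *v column j B))\<^sup>2)"
    by (simp add: power2_norm_eq_sum_columns[of "A ** B"] column_matrix_mult)
  also have "\<dots> \<le> (\<Sum>j\<in>UNIV. (norm A * norm (column j B))\<^sup>2)"
    by (intro sum_mono power_mono norm_matrix_vector_mult_le) simp
  also have "\<dots> = (norm A * norm B)\<^sup>2"
    by (simp add: power2_norm_eq_sum_columns[of B] power_mult_distrib sum_distrib_left)
  finally show "(norm (A ** B))\<^sup>2 \<le> (norm A * norm B)\<^sup>2" .
qed simp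

lemma norm_matrix_mult_le_trans:
  fixes A :: "real ^ 'n ^ 'm" and B :: "real ^ 'p ^ 'n"
  assumes "norm A \<le> a" "norm B \<le> b"
  shows "norm (A ** B) \<le> a * b"
  using norm_matrix_mult_le[of A B] mult_mono[OF assms] assms
  by (meson norm_ge_zero order_trans)

text \<open>
  With \<open>X ** G ** X = X\<close>, the matrices \<open>X ** G\<close> and \<open>G ** X\<close> are (in general oblique) projections:
  onto the column space of \<open>X\<close>, and along the kernel of \<open>X\<close>. They play the part that the singular
  vectors of \<open>X\<close> have in the usual description of the tangent space.
\<close>

lemma generalized_inverse_exists:
  fixes X :: "real ^ 'n ^ 'm"
  obtains G :: "real ^ 'm ^ 'n" where "X ** G ** X = X"
proof -
  have "\<exists>g. range g \<subseteq> UNIV \<and> linear g \<and> (\<forall>v\<in>((*v) X) ` UNIV. X *v (g v) = v)"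
    by (rule real_vector.linear_exists_right_inverse_on) auto
  then obtain g where g: "linear g" "\<And>u. X *v g (X *v u) = X *v u"
    by blast
  have "X ** matrix g ** X = X"
    by (simp add: matrix_eq matrix_vector_mul_assoc[symmetric] matrix_works g)
  then show ?thesis by (rule that)
qed

lemma generalized_inverse_absorb:
  assumes "X ** G ** X = X"
  shows "X ** (G ** X) = X" "X ** (G ** (X ** B)) = X ** B"
  using assms by (metis matrix_mul_assoc)+

section \<open>Row supports\<close>

lemma row_eq_nth: "row i X = X $ i"
  by (simp add: row_def)

lemma row_support_subset_iff: "row_support X \<subseteq> S \<longleftrightarrow> (\<forall>i. i \<notin> S \<longrightarrow> X $ i = 0)"
  by (auto simp: row_support_def row_eq_nth)

lemma row_support_mult_subset:
  fixes A :: "real ^ 'n ^ 'm" and B :: "real ^ 'p ^ 'n"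
  assumes "row_support A \<subseteq> S"
  shows "row_support (A ** B) \<subseteq> S"
  using assms by (auto simp: row_support_subset_iff matrix_matrix_mult_def vec_eq_iff)

lemma subspace_row_support: "subspace {V :: real ^ 'n ^ 'm. row_support V \<subseteq> S}"
  by (auto simp: subspace_def row_support_subset_iff)

lemma row_support_restrict_rows: "row_support (restrict_rows S X) \<subseteq> S"
  by (auto simp: row_support_subset_iff restrict_rows_def)

lemma restrict_rows_ident:
  assumes "row_support X \<subseteq> S"
  shows "restrict_rows S X = X"
  using assms by (auto simp: restrict_rows_def vec_eq_iff row_support_subset_iff row_eq_nth)

lemma restrict_rows_diff: "restrict_rows S (X - Y) = restrict_rows S X - restrict_rows S Y"
  by (auto simp: restrict_rows_def vec_eq_iff row_eq_nth)

lemma norm_restrict_rows_le: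
  fixes X :: "real ^ 'n ^ 'm"
  shows "norm (restrict_rows S X) \<le> norm X"
  by (rule norm_le_componentwise_cart) (auto simp: restrict_rows_def row_eq_nth)

lemma rank_restrict_rows_le:
  fixes X :: "real ^ 'n ^ 'm"
  shows "rank (restrict_rows S X) \<le> rank X"
proof -
  have "(\<Sum>k\<in>UNIV. (if i = k then 1 else 0) * X $ k $ j) =
      (\<Sum>k\<in>UNIV. if i = k then X $ k $ j else 0)" for i j
    by (intro sum.cong) auto
  then have "restrict_rows S X = restrict_rows S (mat 1) ** X"
    by (simp add: restrict_rows_def vec_eq_iff row_eq_nth matrix_matrix_mult_def mat_def)
  then show ?thesis using rank_mul_le_right[of "restrict_rows S (mat 1)" X] by simp
qed

section \<open>The tangent space of the matrices of bounded rank and prescribed row support\<close>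

text \<open>
  A perturbation that does not raise the rank has a normal component of second order. For small
  \<open>E\<close> the matrix \<open>Y = X + E\<close> is still injective on \<open>W\<close>, the range of \<open>Q = G ** X\<close>, whose dimension is
  the rank of \<open>X\<close>. If \<open>Y\<close> has no larger rank, then \<open>Y\<close> maps \<open>W\<close> onto its whole range, so the values
  of \<open>Y\<close> on the kernel of \<open>X\<close> are attained on \<open>W\<close>: \<open>Y ** R = Y ** V\<close> with \<open>Q ** V = V\<close>. Since
  \<open>Y ** R = E ** R\<close> is of order \<open>E\<close>, so is \<open>V\<close>; and the projection \<open>mat 1 - X ** G\<close>
  annihilates \<open>X\<close>, which turns \<open>E ** R\<close> into \<open>E ** V\<close>, of order \<open>E\<close> squared.
\<close>

lemma rank_perturbation_normal_component:
  fixes X E :: "real ^ 'n ^ 'm" and G :: "real ^ 'm ^ 'n"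
  assumes G: "X ** G ** X = X" and rk: "rank (X + E) \<le> rank X"
    and small: "norm G * norm E \<le> 1 / 2"
  shows "norm ((mat 1 - X ** G) ** E ** (mat 1 - G ** X)) \<le>
    norm (mat 1 - X ** G) * (norm E * (2 * (norm G * norm E * norm (mat 1 - G ** X))))"
proof -
  define Y Q R where "Y = X + E" and "Q = G ** X" and "R = mat 1 - Q"
  note absorb = generalized_inverse_absorb[OF G]
  have QQ: "Q ** Q = Q" and XQ: "X ** Q = X"
    by (simp_all add: Q_def matrix_mul_assoc[symmetric] absorb)
  have QR: "Q ** R = 0" and XR: "X ** R = 0"
    by (simp_all add: R_def matrix_mult_expand QQ XQ)
  define W where "W = range ((*v) Q)"
  have W: "subspace W" unfolding W_def
    by (intro linear_subspace_image) auto
  have QW: "Q *v w = w" if "w \<in> W" for w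
    using that QQ by (auto simp: W_def matrix_vector_mul_assoc)
  have inj: "inj_on ((*v) Y) W"
  proof (rule inj_onI)
    fix a b assume ab: "a \<in> W" "b \<in> W" and eq: "Y *v a = Y *v b"
    define w where "w = a - b"
    have "w \<in> W" using ab W subspace_diff w_def by blast
    have "Y *v w = 0" using eq by (simp add: w_def matrix_vector_mult_diff_distrib)
    then have "G *v (X *v w) = - (G *v (E *v w))"
      by (metis Y_def add_eq_0_iff2 matrix_vector_mult_add_rdistrib matrix_vector_right_distrib
          matrix_vector_mult_0_right)
    then have "w = - ((G ** E) *v w)"
      using QW[OF \<open>w \<in> W\<close>] by (simp add: Q_def matrix_vector_mul_assoc)
    then have "norm w \<le> norm (G ** E) * norm w"
      by (metis norm_matrix_vector_mult_le norm_minus_cancel)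
    also have "\<dots> \<le> (1 / 2) * norm w"
      using norm_matrix_mult_le[of G E] small by (intro mult_right_mono) auto
    finally show "a = b" by (simp add: w_def)
  qed
  have "rank X \<le> rank Q" using rank_mul_le_right[of X Q] XQ by simp
  also have "rank Q = dim W" by (simp add: rank_dim_range W_def)
  also have "dim W = dim ((*v) Y ` W)"
    using dim_image_eq[of "(*v) Y" W] inj W by (simp add: span_eq_iff[THEN iffD2])
  finally have "dim (range ((*v) Y)) \<le> dim ((*v) Y ` W)"
    using rk by (simp add: rank_dim_range Y_def)
  then have onto: "(*v) Y ` W = range ((*v) Y)"
    by (intro subspace_dim_equal linear_subspace_image W) auto
  have "\<exists>w. w \<in> W \<and> Y *v w = Y *v column j R" for j
    using onto by (metis imageE rangeI)
  then obtain w where w: "\<And>j. w j \<in> W" "\<And>j. Y *v w j = Y *v column j R" by metis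
  define V :: "real ^ 'n ^ 'n" where "V = (\<chi> i j. w j $ i)"
  have colV: "column j V = w j" for j by (simp add: V_def column_def)
  have matrix_eqI: "A = B" if "\<And>j. column j A = column j B" for A B :: "real ^ 'n ^ 'k"
    using that by (simp add: column_def vec_eq_iff)
  have QV: "Q ** V = V" by (rule matrix_eqI) (simp add: column_matrix_mult colV QW w)
  have YV: "Y ** V = Y ** R" by (rule matrix_eqI) (simp add: column_matrix_mult colV w)
  have "V = G ** (Y ** V) - G ** (E ** V)"
    by (subst QV[symmetric]) (simp add: Q_def Y_def matrix_mult_expand)
  also have "G ** (Y ** V) = G ** (E ** R)"
    unfolding YV by (simp add: Y_def matrix_mult_expand XR)
  finally have "V = G ** (E ** (R - V))" by (simp add: matrix_mult_expand)
  then have "norm V \<le> norm G * (norm E * norm (R - V))"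
    by (metis norm_matrix_mult_le_trans norm_matrix_mult_le order_refl)
  also have "\<dots> \<le> norm G * norm E * (norm R + norm V)"
    by (simp add: mult.assoc mult_left_mono norm_triangle_ineq4)
  also have "\<dots> \<le> norm G * norm E * norm R + (1 / 2) * norm V"
    using mult_right_mono[OF small norm_ge_zero[of V]] by (simp add: distrib_left)
  finally have nV: "norm V \<le> 2 * (norm G * norm E * norm R)" by simp
  have "(mat 1 - X ** G) ** E ** R = (mat 1 - X ** G) ** (Y ** R)"
    by (simp add: Y_def matrix_mult_expand XR)
  also have "\<dots> = (mat 1 - X ** G) ** (E ** V)"
    unfolding YV[symmetric] by (simp add: Y_def matrix_mult_expand absorb)
  also have "norm \<dots> \<le> norm (mat 1 - X ** G) * (norm E * (2 * (norm G * norm E * norm R)))"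
    by (intro norm_matrix_mult_le_trans order_refl nV)
  finally show ?thesis by (simp add: R_def Q_def)
qed

text \<open>
  Since \<open>mat 1 - G ** X\<close> projects onto the kernel of \<open>X\<close>, and \<open>mat 1 - X ** G\<close> has the column space
  of \<open>X\<close> as its kernel, whenever \<open>X ** G ** X = X\<close>, the equation says that \<open>V\<close> maps the kernel of
  \<open>X\<close> into the column space of \<open>X\<close>. This is the classical tangent space of the matrices of fixed rank; in
  particular it does not depend on the choice of \<open>G\<close>.
\<close>

definition fixed_rank_tangent ::
    "'m set \<Rightarrow> real ^ 'n ^ 'm \<Rightarrow> real ^ 'm ^ 'n \<Rightarrow> (real ^ 'n ^ 'm) set" where
  "fixed_rank_tangent S X G =
    {V. row_support V \<subseteq> S \<and> (mat 1 - X ** G) ** V ** (mat 1 - G ** X) = 0}"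

lemma subspace_fixed_rank_tangent: "subspace (fixed_rank_tangent S X G)"
  using subspace_row_support[of S]
  unfolding fixed_rank_tangent_def subspace_def
  by (simp add: matrix_mult_add_left matrix_mult_add_right matrix_mult_scaleR_left
      matrix_mult_scaleR_right matrix_mult_zero_left matrix_mult_zero_right) blast

text \<open>
  A tangent vector splits as \<open>V = L ** X + X ** N\<close> with \<open>L = V ** G\<close> and
  \<open>N = G ** V ** (mat 1 - G ** X)\<close>. The product \<open>(mat 1 + L) ** X ** (mat 1 + N)\<close> cannot have larger
  rank than \<open>X\<close>, and it differs from \<open>X + V\<close> by the quadratic term \<open>L ** X ** N\<close> only.
\<close>

lemma fixed_rank_tangent_curve:
  fixes X V :: "real ^ 'n ^ 'm" and G :: "real ^ 'm ^ 'n"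
  assumes S: "row_support X \<subseteq> S" and V: "V \<in> fixed_rank_tangent S X G"
  shows "X + V + V ** (G ** (X ** (G ** (V ** (mat 1 - G ** X))))) \<in> rank_row_supported (rank X) S"
    (is "?Z \<in> _")
proof -
  have suppV: "row_support V \<subseteq> S" and V0: "(mat 1 - X ** G) ** V ** (mat 1 - G ** X) = 0"
    using V by (auto simp: fixed_rank_tangent_def)
  have "V = V ** (G ** X) + X ** (G ** (V ** (mat 1 - G ** X)))"
    using V0 by (simp add: matrix_mult_expand algebra_simps)
  then have "?Z = (mat 1 + V ** G) ** X ** (mat 1 + G ** (V ** (mat 1 - G ** X)))"
    by (simp add: matrix_mult_add_left matrix_mult_add_right matrix_mul_assoc[symmetric])
  moreover have "rank (A ** X ** B) \<le> rank X" for A :: "real ^ 'm ^ 'm" and B :: "real ^ 'n ^ 'n"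
    using rank_mul_le_left[of "A ** X" B] rank_mul_le_right[of A X] by linarith
  ultimately have "rank ?Z \<le> rank X"
    by simp
  moreover have "?Z \<in> {V. row_support V \<subseteq> S}"
    using S suppV row_support_mult_subset[OF suppV]
    by (intro subspace_add subspace_row_support) auto
  ultimately show ?thesis by (simp add: rank_row_supported_def)
qed

text \<open>
  Removing the normal component of \<open>Z - X\<close> leaves a tangent vector, and this component is of
  second order by \<open>rank_perturbation_normal_component\<close>; conversely a tangent vector
  \<open>V\<close> is realized up to the quadratic term of \<open>fixed_rank_tangent_curve\<close>.
\<close>

lemma rank_row_supported_first_order_tangent:
  fixes X :: "real ^ 'n ^ 'm" and G :: "real ^ 'm ^ 'n"
  assumes G: "X ** G ** X = X" and S: "row_support X \<subseteq> S"
  shows "first_order_tangent (rank_row_supported (rank X) S) X (fixed_rank_tangent S X G)"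
  unfolding first_order_tangent_def
proof (intro conjI allI impI)
  fix \<eta> :: real assume \<eta>: "\<eta> > 0"
  note absorb = generalized_inverse_absorb[OF G]
  define P' where "P' = mat 1 - X ** G"
  define R where "R = mat 1 - G ** X"
  define C where "C = norm P' * (2 * (norm G * norm R)) + 1"
  have C: "C > 0" by (simp add: C_def add_nonneg_pos)
  have g: "norm G + 1 > 0" by (simp add: add_nonneg_pos)
  define r where "r = min (1 / (2 * (norm G + 1))) (\<eta> / C)"
  show "\<exists>r>0. \<forall>z\<in>rank_row_supported (rank X) S. norm (z - X) \<le> r \<longrightarrow>
      (\<exists>v\<in>fixed_rank_tangent S X G. norm (z - X - v) \<le> \<eta> * norm (z - X))"
  proof (intro exI[of _ r] conjI ballI impI)
    show "r > 0" using \<eta> C g by (simp add: r_def)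
    fix Z assume Z: "Z \<in> rank_row_supported (rank X) S" "norm (Z - X) \<le> r"
    define E where "E = Z - X"
    have e1: "norm E \<le> 1 / (2 * (norm G + 1))" and e2: "norm E \<le> \<eta> / C"
      using Z(2) by (auto simp: E_def r_def)
    have suppE: "row_support E \<subseteq> S"
      using Z(1) S subspace_diff[OF subspace_row_support[of S], of Z X]
      by (auto simp: E_def rank_row_supported_def)
    have "(norm G + 1) * norm E \<le> 1 / 2" using e1 g by (simp add: field_simps)
    then have small: "norm G * norm E \<le> 1 / 2"
      using norm_ge_zero[of E] by (simp add: distrib_right del: norm_ge_zero)
    have "norm (P' ** E ** R) \<le> norm P' * (norm E * (2 * (norm G * norm E * norm R)))"
      unfolding P'_def R_def
      by (rule rank_perturbation_normal_component[OF G _ small])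
        (use Z(1) in \<open>simp add: E_def rank_row_supported_def\<close>)
    also have "\<dots> = (C - 1) * norm E * norm E" by (simp add: C_def)
    also have "\<dots> \<le> C * norm E * norm E" by (intro mult_right_mono) auto
    also have "\<dots> \<le> \<eta> * norm E"
      using e2 C by (intro mult_right_mono) (auto simp: field_simps)
    finally have bound: "norm (P' ** E ** R) \<le> \<eta> * norm E" .
    have PP: "P' ** P' = P'" and RR: "R ** R = R"
      by (simp_all add: P'_def R_def matrix_mult_expand absorb)
    have "P' ** (E - P' ** E ** R) ** R = P' ** E ** R - (P' ** P') ** E ** (R ** R)"
      by (simp add: matrix_mult_expand)
    then have normal: "P' ** (E - P' ** E ** R) ** R = 0" by (simp add: PP RR)
    have "row_support (X ** (G ** (E ** R))) \<subseteq> S" "row_support (E ** R) \<subseteq> S"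
      using row_support_mult_subset S suppE by blast+
    then have "E - (E ** R - X ** (G ** (E ** R))) \<in> {V. row_support V \<subseteq> S}"
      using suppE by (intro subspace_diff subspace_row_support) auto
    then have "row_support (E - P' ** E ** R) \<subseteq> S"
      by (simp add: P'_def matrix_mult_diff_left matrix_mul_assoc[symmetric])
    with normal have "E - P' ** E ** R \<in> fixed_rank_tangent S X G"
      by (simp add: fixed_rank_tangent_def P'_def R_def)
    with bound show "\<exists>v\<in>fixed_rank_tangent S X G. norm (Z - X - v) \<le> \<eta> * norm (Z - X)"
      unfolding E_def[symmetric] by (intro bexI[of _ "E - P' ** E ** R"]) auto
  qed
next
  fix \<eta> :: real assume \<eta>: "\<eta> > 0"
  define R where "R = mat 1 - G ** X"
  define C where "C = norm G * (norm X * (norm G * norm R)) + 1"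
  have C: "C > 0" by (simp add: C_def add_nonneg_pos)
  show "\<exists>r>0. \<forall>v\<in>fixed_rank_tangent S X G. norm v \<le> r \<longrightarrow>
      (\<exists>z\<in>rank_row_supported (rank X) S. norm (z - X - v) \<le> \<eta> * norm v)"
  proof (intro exI[of _ "\<eta> / C"] conjI ballI impI)
    show "\<eta> / C > 0" using \<eta> C by simp
    fix V assume V: "V \<in> fixed_rank_tangent S X G" "norm V \<le> \<eta> / C"
    define F where "F = V ** (G ** (X ** (G ** (V ** R))))"
    have "norm F \<le> norm V * (norm G * (norm X * (norm G * (norm V * norm R))))"
      unfolding F_def by (intro norm_matrix_mult_le_trans order_refl)
    also have "\<dots> = (C - 1) * norm V * norm V" by (simp add: C_def)
    also have "\<dots> \<le> C * norm V * norm V" by (intro mult_right_mono) auto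
    also have "\<dots> \<le> \<eta> * norm V"
      using V(2) C by (intro mult_right_mono) (auto simp: field_simps)
    finally show "\<exists>z\<in>rank_row_supported (rank X) S. norm (z - X - V) \<le> \<eta> * norm V"
      using fixed_rank_tangent_curve[OF S V(1)]
      by (intro bexI[of _ "X + V + F"]) (auto simp: F_def R_def)
  qed
qed

lemma smooth_curve_on_quadratic:
  fixes a v w :: "'a::real_normed_vector"
  shows "smooth_curve_on I (\<lambda>t. a + t *\<^sub>R v + t\<^sup>2 *\<^sub>R w)"
proof -
  define D where "D = (\<lambda>(n::nat) (t::real). if n = 0 then a + t *\<^sub>R v + t\<^sup>2 *\<^sub>R w
    else if n = 1 then v + (2 * t) *\<^sub>R w else if n = 2 then 2 *\<^sub>R w else 0)"
  have D0: "D 0 = (\<lambda>t. a + t *\<^sub>R v + t\<^sup>2 *\<^sub>R w)" by (simp add: D_def)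
  have "(D n has_vector_derivative D (Suc n) t) (at t)" for n t
  proof -
    consider "n = 0" | "n = 1" | "n \<ge> 2" by linarith
    then show ?thesis
    proof cases
      case 1
      then show ?thesis unfolding D_def
        by (auto intro!: derivative_eq_intros)
    next
      case 2
      then show ?thesis unfolding D_def
        by (auto intro!: derivative_eq_intros)
    next
      case 3
      then have "D n = (\<lambda>_. if n = 2 then 2 *\<^sub>R w else 0)" "D (Suc n) t = 0"
        by (auto simp: D_def)
      then show ?thesis by simp
    qed
  qed
  with D0 show ?thesis unfolding smooth_curve_on_def by blast
qed

text \<open>
  For the inclusion from right to left, scaling \<open>V\<close> by \<open>t\<close> in \<open>fixed_rank_tangent_curve\<close> gives a
  curve that is quadratic in \<open>t\<close>, hence smooth, with velocity \<open>V\<close>. As a consequence the set of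
  velocities is a linear subspace, so that orthogonal projection onto it makes sense.
\<close>

lemma tangent_space_rank_row_supported:
  fixes X :: "real ^ 'n ^ 'm" and G :: "real ^ 'm ^ 'n"
  assumes G: "X ** G ** X = X" and S: "row_support X \<subseteq> S"
  shows "tangent_space (rank_row_supported (rank X) S) X = fixed_rank_tangent S X G"
proof
  show "tangent_space (rank_row_supported (rank X) S) X \<subseteq> fixed_rank_tangent S X G"
    by (intro tangent_space_subset subspace_fixed_rank_tangent
        rank_row_supported_first_order_tangent assms)
  show "fixed_rank_tangent S X G \<subseteq> tangent_space (rank_row_supported (rank X) S) X"
  proof
    fix V assume V: "V \<in> fixed_rank_tangent S X G"
    define F where "F = V ** (G ** (X ** (G ** (V ** (mat 1 - G ** X)))))"
    define c where "c = (\<lambda>t::real. X + t *\<^sub>R V + t\<^sup>2 *\<^sub>R F)"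
    have "c t \<in> rank_row_supported (rank X) S" for t
      using fixed_rank_tangent_curve[OF S subspace_scale[OF subspace_fixed_rank_tangent V, of t]]
      by (simp add: c_def F_def matrix_mult_scaleR_left matrix_mult_scaleR_right power2_eq_square)
    moreover have "smooth_curve_on {-1<..<1} c"
      unfolding c_def by (rule smooth_curve_on_quadratic)
    moreover have "(c has_vector_derivative V) (at 0)"
      unfolding c_def by (auto intro!: derivative_eq_intros)
    moreover have "c 0 = X" by (simp add: c_def)
    ultimately show "V \<in> tangent_space (rank_row_supported (rank X) S) X"
      unfolding tangent_space_def by (intro CollectI exI[of _ c] exI[of _ "1::real"]) auto
  qed
qed

section \<open>Row thresholding and rank truncation near a matrix with full row budget\<close>

text \<open>
  One threshold \<open>r\<close>, a third of the smallest nonzero row norm of \<open>X\<close> or of \<open>1\<close>, whichever is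
  smaller, separates the rows in the support of \<open>X\<close> from the others simultaneously for all
  matrices near \<open>X\<close>. The \<open>1\<close> covers \<open>X = 0\<close>.
\<close>

lemma row_support_gap:
  fixes X :: "real ^ 'n ^ 'm"
  obtains r where "r > 0"
    "\<And>Z i. norm (Z - X) \<le> r \<Longrightarrow> i \<in> row_support X \<Longrightarrow> r < norm (row i Z)"
    "\<And>Z i. norm (Z - X) \<le> r \<Longrightarrow> i \<notin> row_support X \<Longrightarrow> norm (row i Z) \<le> r"
proof -
  define \<mu> where "\<mu> = Min (insert 1 ((\<lambda>i. norm (row i X)) ` row_support X))"
  have \<mu>: "\<mu> > 0" by (simp add: \<mu>_def row_support_def)
  have \<mu>_le: "\<mu> \<le> norm (row i X)" if "i \<in> row_support X" for i
    using that by (simp add: \<mu>_def)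
  have diff: "norm (row i Z - row i X) \<le> norm (Z - X)" for i Z
    using Finite_Cartesian_Product.norm_nth_le[of "Z - X" i] by (simp add: row_eq_nth)
  show ?thesis
  proof (rule that[of "\<mu> / 3"])
    show "\<mu> / 3 > 0" using \<mu> by simp
    fix Z :: "real ^ 'n ^ 'm" and i assume Z: "norm (Z - X) \<le> \<mu> / 3"
    show "\<mu> / 3 < norm (row i Z)" if "i \<in> row_support X"
      using \<mu>_le[OF that] diff[of i Z] Z \<mu> norm_triangle_ineq2[of "row i X" "row i Z"]
      by (simp add: norm_minus_commute)
    show "norm (row i Z) \<le> \<mu> / 3" if "i \<notin> row_support X"
      using that diff[of i Z] Z by (simp add: row_support_def)
  qed
qed

text \<open>
  If \<open>X\<close> has exactly \<open>s\<close> nonzero rows, then near \<open>X\<close> these are the \<open>s\<close> rows of largest norm, with no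
  ties across the boundary, so every selection rule chooses them.
\<close>

lemma row_threshold_near:
  fixes X :: "real ^ 'n ^ 'm"
  assumes H: "is_row_threshold s H" and s: "row_norm0 X = s"
  obtains r where "r > 0"
    "\<And>Z. norm (Z - X) \<le> r \<Longrightarrow> H Z = restrict_rows (row_support X) Z"
proof -
  obtain r where r: "r > 0"
    "\<And>Z i. norm (Z - X) \<le> r \<Longrightarrow> i \<in> row_support X \<Longrightarrow> r < norm (row i Z)"
    "\<And>Z i. norm (Z - X) \<le> r \<Longrightarrow> i \<notin> row_support X \<Longrightarrow> norm (row i Z) \<le> r"
    using row_support_gap[of X] by blast
  show ?thesis
  proof (rule that[OF r(1)])
    fix Z assume Z: "norm (Z - X) \<le> r"
    obtain S where S: "card S = s" "\<And>i j. i \<in> S \<Longrightarrow> j \<notin> S \<Longrightarrow> norm (row j Z) \<le> norm (row i Z)"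
      "H Z = restrict_rows S Z"
      using H unfolding is_row_threshold_def by meson
    have "S \<subseteq> row_support X \<or> row_support X \<subseteq> S"
    proof (rule ccontr)
      assume "\<not> ?thesis"
      then obtain i j where "i \<in> S" "i \<notin> row_support X" "j \<in> row_support X" "j \<notin> S" by blast
      then show False using r(2,3)[OF Z] S(2) by (meson not_le order_trans)
    qed
    moreover have "card S = card (row_support X)" using S(1) s by (simp add: row_norm0_def)
    ultimately have "S = row_support X"
      by (metis card_subset_eq finite)
    then show "H Z = restrict_rows (row_support X) Z" using S(3) by simp
  qed
qed

lemma row_support_eq_near:
  fixes X :: "real ^ 'n ^ 'm"
  obtains r where "r > 0"
    "\<And>Z. norm (Z - X) \<le> r \<Longrightarrow> row_norm0 Z \<le> row_norm0 X \<Longrightarrow> row_support Z = row_support X"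
proof -
  obtain r where r: "r > 0"
    "\<And>Z i. norm (Z - X) \<le> r \<Longrightarrow> i \<in> row_support X \<Longrightarrow> r < norm (row i Z)"
    using row_support_gap[of X] by metis
  show ?thesis
  proof (rule that[OF r(1)])
    fix Z assume Z: "norm (Z - X) \<le> r" and le: "row_norm0 Z \<le> row_norm0 X"
    have "row_support X \<subseteq> row_support Z"
      using r(1) r(2)[OF Z] by (fastforce simp: row_support_def)
    with le show "row_support Z = row_support X"
      using card_seteq[of "row_support Z" "row_support X"] by (simp add: row_norm0_def)
  qed
qed

text \<open>
  Deleting the rows of \<open>T B\<close> outside \<open>S\<close> does not raise the rank and, as \<open>B\<close> vanishes there,
  reduces the squared distance to \<open>B\<close> by the squared norms of these rows. Optimality of \<open>T B\<close>
  forces them to be zero.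
\<close>

lemma rank_truncation_row_support:
  fixes B :: "real ^ 'n ^ 'm"
  assumes T: "is_rank_truncation k T" and B: "row_support B \<subseteq> S"
  shows "row_support (T B) \<subseteq> S"
proof -
  define Y where "Y = T B"
  have Y: "rank Y \<le> k" "\<And>Z. rank Z \<le> k \<Longrightarrow> norm (B - Y) \<le> norm (B - Z)"
    using T by (auto simp: is_rank_truncation_def Y_def)
  have "norm (B - Y) \<le> norm (B - restrict_rows S Y)"
    by (intro Y(2) order_trans[OF rank_restrict_rows_le Y(1)])
  then have "(norm (B - Y))\<^sup>2 \<le> (norm (B - restrict_rows S Y))\<^sup>2"
    by (simp add: power_mono)
  also have "B - restrict_rows S Y = restrict_rows S (B - Y)"
    by (simp add: restrict_rows_diff restrict_rows_ident[OF B])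
  also have "(norm (restrict_rows S (B - Y)))\<^sup>2 = (\<Sum>i\<in>UNIV. if i \<in> S then (norm ((B - Y) $ i))\<^sup>2 else 0)"
    unfolding power2_norm_eq_sum_rows[of "restrict_rows S (B - Y)"]
    by (intro sum.cong) (auto simp: restrict_rows_def row_eq_nth)
  finally have "(\<Sum>i\<in>UNIV. (norm ((B - Y) $ i))\<^sup>2 - (if i \<in> S then (norm ((B - Y) $ i))\<^sup>2 else 0)) \<le> 0"
    by (simp add: power2_norm_eq_sum_rows[of "B - Y"] sum_subtractf)
  moreover have "0 \<le> (norm ((B - Y) $ i))\<^sup>2 - (if i \<in> S then (norm ((B - Y) $ i))\<^sup>2 else 0)" for i
    by simp
  ultimately have "(norm ((B - Y) $ i))\<^sup>2 - (if i \<in> S then (norm ((B - Y) $ i))\<^sup>2 else 0) = 0" for i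
    by (meson UNIV_I finite order_antisym sum_nonneg sum_nonneg_eq_0_iff)
  then have "(B - Y) $ i = 0" if "i \<notin> S" for i
    using that by (metis diff_zero norm_eq_zero power_eq_0_iff)
  then show ?thesis using B by (auto simp: row_support_subset_iff Y_def)
qed

text \<open>
  On matrices with rows in \<open>S\<close>, the best approximation of rank at most \<open>k\<close> is thus also a nearest
  point in the smaller set \<open>rank_row_supported k S\<close>, so that \<open>nearest_point_first_order\<close> applies.
\<close>

lemma rank_truncation_nearest:
  assumes T: "is_rank_truncation k T" and B: "row_support B \<subseteq> S"
  shows "T B \<in> rank_row_supported k S"
    and "q \<in> rank_row_supported k S \<Longrightarrow> norm (B - T B) \<le> norm (B - q)"
  using T rank_truncation_row_support[OF T B]
  by (auto simp: is_rank_truncation_def rank_row_supported_def)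

lemma thresholding_maps_into_rank_row_sparse:
  fixes H T :: "real ^ 'n ^ 'm \<Rightarrow> real ^ 'n ^ 'm"
  assumes H: "is_row_threshold s H" and T: "is_rank_truncation k T"
  shows "T (H Z) \<in> rank_row_sparse k s"
proof -
  obtain S where S: "card S = s" "H Z = restrict_rows S Z"
    using H unfolding is_row_threshold_def by blast
  have "T (H Z) \<in> rank_row_supported k S"
    unfolding S(2) by (rule rank_truncation_nearest[OF T row_support_restrict_rows])
  then show ?thesis
    using card_mono[of S] S(1) by (auto simp: rank_row_supported_def rank_row_sparse_def row_norm0_def)
qed

lemma orth_proj_restrict_rows:
  fixes T :: "(real ^ 'n ^ 'm) set"
  assumes T: "subspace T" and S: "\<And>V. V \<in> T \<Longrightarrow> row_support V \<subseteq> S"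
  shows "orth_proj T (restrict_rows S Z) = orth_proj T Z"
proof (rule orth_proj_eqI[OF T orth_proj_in[OF T]])
  fix V assume V: "V \<in> T"
  have "restrict_rows S Z \<bullet> V = Z \<bullet> V"
    using S[OF V] unfolding inner_vec_def[of _ V]
    by (intro sum.cong) (auto simp: restrict_rows_def row_eq_nth row_support_subset_iff)
  then show "orthogonal (restrict_rows S Z - orth_proj T Z) V"
    using orth_proj_orthogonal[OF T V, of Z] by (simp add: orthogonal_def inner_diff_left)
qed

section \<open>Local convergence of iterative hard thresholding\<close>

text \<open>
  Near \<open>X\<close> the row thresholding is the fixed linear map \<open>restrict_rows (row_support X)\<close>, which
  does not change the projection onto \<open>U\<close>, and the rank truncation is a nearest-point map. Hence
  the composition has the derivative \<open>orth_proj U\<close> at \<open>X\<close>.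
\<close>

lemma thresholding_step_first_order:
  fixes H T :: "real ^ 'n ^ 'm \<Rightarrow> real ^ 'n ^ 'm" and X :: "real ^ 'n ^ 'm"
  assumes H: "is_row_threshold s H" and T: "is_rank_truncation k T"
    and s: "row_norm0 X = s" and k: "rank X = k"
    and sub: "subspace U" and U: "first_order_tangent (rank_row_supported k (row_support X)) X U"
    and supp: "\<And>V. V \<in> U \<Longrightarrow> row_support V \<subseteq> row_support X"
    and \<eta>: "\<eta> > 0"
  obtains r where "r > 0"
    "\<And>Z. norm (Z - X) \<le> r \<Longrightarrow> norm (T (H Z) - X - orth_proj U (Z - X)) \<le> \<eta> * norm (Z - X)"
proof -
  define S where "S = row_support X"
  have X: "X \<in> rank_row_supported k S" by (simp add: rank_row_supported_def k S_def)
  obtain r1 where r1: "r1 > 0" "\<And>Z. norm (Z - X) \<le> r1 \<Longrightarrow> H Z = restrict_rows S Z"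
    using row_threshold_near[OF H s] unfolding S_def by blast
  obtain r2 where r2: "r2 > 0"
    "\<And>z p. norm (z - X) \<le> r2 \<Longrightarrow> p \<in> rank_row_supported k S \<Longrightarrow>
       (\<And>q. q \<in> rank_row_supported k S \<Longrightarrow> norm (z - p) \<le> norm (z - q)) \<Longrightarrow>
       norm (p - X - orth_proj U (z - X)) \<le> \<eta> * norm (z - X)"
    using nearest_point_first_order[OF sub U[folded S_def] X \<eta>] by blast
  show ?thesis
  proof (rule that[of "min r1 r2"])
    show "min r1 r2 > 0" using r1(1) r2(1) by simp
    fix Z assume Z: "norm (Z - X) \<le> min r1 r2"
    define B where "B = restrict_rows S Z"
    have HZ: "H Z = B" using r1(2) Z by (simp add: B_def)
    have BX: "B - X = restrict_rows S (Z - X)"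
      by (simp add: B_def restrict_rows_diff restrict_rows_ident S_def)
    have le: "norm (B - X) \<le> norm (Z - X)"
      unfolding BX by (rule norm_restrict_rows_le)
    have B: "row_support B \<subseteq> S" unfolding B_def by (rule row_support_restrict_rows)
    have "norm (T B - X - orth_proj U (B - X)) \<le> \<eta> * norm (B - X)"
    proof (rule r2(2))
      show "norm (B - X) \<le> r2" using le Z by linarith
      show "T B \<in> rank_row_supported k S" by (rule rank_truncation_nearest(1)[OF T B])
      show "norm (B - T B) \<le> norm (B - q)" if "q \<in> rank_row_supported k S" for q
        using that by (rule rank_truncation_nearest(2)[OF T B])
    qed
    also have "\<dots> \<le> \<eta> * norm (Z - X)"
      using le \<eta> by (intro mult_left_mono) auto
    also have "orth_proj U (B - X) = orth_proj U (Z - X)"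
      unfolding BX by (rule orth_proj_restrict_rows[OF sub]) (use supp S_def in auto)
    finally show "norm (T (H Z) - X - orth_proj U (Z - X)) \<le> \<eta> * norm (Z - X)"
      by (simp add: HZ)
  qed
qed

lemma compressed_operator_bound:
  fixes U :: "'a::euclidean_space set"
  assumes sub: "subspace U" and B: "linear B"
  shows "0 \<le> spectral_norm_on U B"
    and "norm (orth_proj U (B (orth_proj U x))) \<le> spectral_norm_on U B * norm x"
proof -
  have "linear (orth_proj U \<circ> B \<circ> orth_proj U)"
    by (intro linear_compose linear_orth_proj[OF sub] B)
  then have bl: "bounded_linear (orth_proj U \<circ> B \<circ> orth_proj U)"
    by (simp add: linear_conv_bounded_linear)
  show "0 \<le> spectral_norm_on U B"
    unfolding spectral_norm_on_def by (rule onorm_pos_le[OF bl])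
  show "norm (orth_proj U (B (orth_proj U x))) \<le> spectral_norm_on U B * norm x"
    using onorm[OF bl, of x] by (simp add: spectral_norm_on_def)
qed

theorem proposition2p6:
  fixes A :: "real ^ 'n ^ 'm \<Rightarrow> real ^ 'p"
    and y :: "real ^ 'p"
    and k s :: nat
    and H T :: "real ^ 'n ^ 'm \<Rightarrow> real ^ 'n ^ 'm"
    and Xstar :: "real ^ 'n ^ 'm"
    and Sstar :: "'m set"
    and \<delta> :: real
  assumes "linear A"
    and "0 < k" and "k < s"
    and "is_row_threshold s H" and "is_rank_truncation k T"
    and "A Xstar = y" and "Xstar \<in> rank_row_sparse k s"
    and "row_norm0 Xstar = s"
    and "rank Xstar = min k s"
    and "Sstar = row_support Xstar"
    and "spectral_norm_on (tangent_space (rank_row_supported k Sstar) Xstar)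
           (\<lambda>X. X - adjoint A (A X)) = \<delta>"
    and "\<delta> < 1"
  shows "\<exists>\<epsilon>>0. \<forall>X :: nat \<Rightarrow> real ^ 'n ^ 'm.
           X 0 \<in> rank_row_sparse k s \<longrightarrow>
           (\<forall>l. X (Suc l) = (T \<circ> H) (X l - adjoint A (A (X l) - y))) \<longrightarrow>
           (\<exists>l. norm (X l - Xstar) \<le> \<epsilon>) \<longrightarrow>
           X \<longlonglongrightarrow> Xstar \<and>
           limsup (\<lambda>l. ereal (norm (X (Suc l) - Xstar) / norm (X l - Xstar))) \<le> ereal \<delta>"
proof -
  note H = assms(4) and T = assms(5)
  have rk: "rank Xstar = k" using assms(3,9) by simp
  define V where "V = (rank_row_supported k Sstar :: (real ^ 'n ^ 'm) set)"
  define B where "B = (\<lambda>X. X - adjoint A (A X))"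
  define \<Phi> where "\<Phi> = (\<lambda>X. (T \<circ> H) (X - adjoint A (A X - y)))"
  define M where "M = (rank_row_sparse k s :: (real ^ 'n ^ 'm) set)"
  obtain G where G: "Xstar ** G ** Xstar = Xstar" using generalized_inverse_exists by blast
  define U where "U = fixed_rank_tangent Sstar Xstar G"
  have S: "row_support Xstar \<subseteq> Sstar" using assms(10) by simp
  have sub: "subspace U" unfolding U_def by (rule subspace_fixed_rank_tangent)
  have tangent: "tangent_space V Xstar = U"
    using tangent_space_rank_row_supported[OF G S] by (simp add: V_def U_def rk)
  have first_order: "first_order_tangent V Xstar U"
    using rank_row_supported_first_order_tangent[OF G S] by (simp add: V_def U_def rk)
  have suppU: "row_support W \<subseteq> row_support Xstar" if "W \<in> U" for W
    using that assms(10) by (simp add: U_def fixed_rank_tangent_def)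
  have linB: "linear B"
    unfolding B_def
    by (intro linear_compose_sub linear_id linear_compose[OF assms(1) adjoint_linear[OF assms(1)],
          unfolded o_def]) (simp add: linear_iff)
  have \<delta>: "spectral_norm_on U B = \<delta>"
    using assms(11) tangent by (simp add: V_def B_def)
  have \<delta>0: "0 \<le> \<delta>" using compressed_operator_bound(1)[OF sub linB] \<delta> by simp
  obtain K where K: "K > 0" "\<And>x. norm (B x) \<le> norm x * K"
    using bounded_linear.pos_bounded linB linear_conv_bounded_linear by blast
  \<comment> \<open>With exact data the gradient step acts on the error \<open>X - Xstar\<close> as the linear map \<open>B\<close>.\<close>
  have gradient_step: "X - adjoint A (A X - y) - Xstar = B (X - Xstar)" for X
    using assms(6) by (simp add: B_def linear_diff[OF assms(1)])
  have contraction: "\<exists>r>0. \<forall>X\<in>M. norm (X - Xstar) \<le> r \<longrightarrow>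
      norm (\<Phi> X - Xstar) \<le> (\<delta> + \<eta>) * norm (X - Xstar)" if \<eta>: "\<eta> > 0" for \<eta>
  proof -
    \<comment> \<open>Two errors of size \<open>\<eta>' * K * norm E\<close> arise, one from the step itself and one from replacing
      \<open>E\<close> by its projection; each may use up half of \<open>\<eta>\<close>.\<close>
    define \<eta>' where "\<eta>' = \<eta> / (2 * K)"
    have \<eta>': "\<eta>' > 0" "\<eta>' * K = \<eta> / 2" using \<eta> K by (auto simp: \<eta>'_def)
    obtain r1 where r1: "r1 > 0"
      "\<And>Z. norm (Z - Xstar) \<le> r1 \<Longrightarrow>
         norm (T (H Z) - Xstar - orth_proj U (Z - Xstar)) \<le> \<eta>' * norm (Z - Xstar)"
      using thresholding_step_first_order[OF H T assms(8) rk sub _ suppU \<eta>'(1)] first_order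
      unfolding V_def assms(10) by blast
    obtain r2 where r2: "r2 > 0"
      "\<And>X. X \<in> V \<Longrightarrow> norm (X - Xstar) \<le> r2 \<Longrightarrow>
         \<exists>v\<in>U. norm (X - Xstar - v) \<le> \<eta>' * norm (X - Xstar)"
      using first_order_tangentD1[OF first_order \<eta>'(1)] by blast
    obtain r3 where r3: "r3 > 0"
      "\<And>X. norm (X - Xstar) \<le> r3 \<Longrightarrow> row_norm0 X \<le> row_norm0 Xstar \<Longrightarrow>
         row_support X = row_support Xstar"
      using row_support_eq_near[of Xstar] by blast
    show ?thesis
    proof (intro exI[of _ "min (r1 / K) (min r2 r3)"] conjI ballI impI)
      show "min (r1 / K) (min r2 r3) > 0" using r1(1) r2(1) r3(1) K(1) by simp
      fix X assume X: "X \<in> M" "norm (X - Xstar) \<le> min (r1 / K) (min r2 r3)"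
      define E where "E = X - Xstar"
      define P where "P = orth_proj U E"
      define Z where "Z = X - adjoint A (A X - y)"
      have ZE: "Z - Xstar = B E" by (simp add: Z_def E_def gradient_step)
      have "norm E * K \<le> r1" using X(2) K(1) by (simp add: E_def field_simps)
      then have BE: "norm (Z - Xstar) \<le> r1" using K(2)[of E] ZE by simp
      \<comment> \<open>A matrix near \<open>Xstar\<close> with at most \<open>s\<close> nonzero rows has its rows in \<open>Sstar\<close>, since none of
        the \<open>s\<close> nonzero rows of \<open>Xstar\<close> can vanish.\<close>
      have "X \<in> V"
        using X r3(2)[of X] assms(8,10)
        by (simp add: M_def V_def rank_row_sparse_def rank_row_supported_def)
      then obtain v where v: "v \<in> U" "norm (E - v) \<le> \<eta>' * norm E"
        using r2(2) X(2) unfolding E_def by auto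
      have "(norm (E - P))\<^sup>2 \<le> (norm (E - v))\<^sup>2"
        using orth_proj_pythagoras[OF sub v(1), of E] by (simp add: P_def)
      then have EP: "norm (E - P) \<le> \<eta>' * norm E"
        using v(2) power2_le_imp_le norm_ge_zero order_trans by blast
      have "norm (orth_proj U (B (E - P))) \<le> norm (B (E - P))"
        by (rule norm_orth_proj_le[OF sub])
      also have "\<dots> \<le> norm (E - P) * K" by (rule K(2))
      also have "\<dots> \<le> \<eta>' * norm E * K" using EP K(1) by (intro mult_right_mono) auto
      also have "\<dots> = \<eta> / 2 * norm E" using \<eta>'(2) by (simp add: mult.commute mult.left_commute)
      finally have t1: "norm (orth_proj U (B (E - P))) \<le> \<eta> / 2 * norm E" .
      have t2: "norm (orth_proj U (B P)) \<le> \<delta> * norm E"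
        using compressed_operator_bound(2)[OF sub linB, of E] \<delta> by (simp add: P_def)
      have "norm (\<Phi> X - Xstar - orth_proj U (B E)) \<le> \<eta>' * norm (B E)"
        using r1(2)[OF BE] unfolding ZE by (simp add: \<Phi>_def Z_def)
      also have "\<dots> \<le> \<eta>' * (norm E * K)" using K(2) \<eta>'(1) by (intro mult_left_mono) auto
      also have "\<dots> = \<eta> / 2 * norm E" using \<eta>'(2) by (simp add: mult.commute mult.left_commute)
      finally have t3: "norm (\<Phi> X - Xstar - orth_proj U (B E)) \<le> \<eta> / 2 * norm E" .
      \<comment> \<open>The second summand is the compression of \<open>B\<close> to \<open>U\<close>, whose norm is \<open>\<delta>\<close>.\<close>
      have "orth_proj U (B E) = orth_proj U (B (E - P)) + orth_proj U (B P)"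
        using linear_add[OF linear_orth_proj[OF sub], of "B (E - P)" "B P"]
          linear_add[OF linB, of "E - P" P] by simp
      then have "norm (\<Phi> X - Xstar) = norm ((\<Phi> X - Xstar - orth_proj U (B E)) +
          (orth_proj U (B (E - P)) + orth_proj U (B P)))"
        by (metis diff_add_cancel)
      also have "\<dots> \<le> norm (\<Phi> X - Xstar - orth_proj U (B E)) +
          (norm (orth_proj U (B (E - P))) + norm (orth_proj U (B P)))"
        by (intro norm_triangle_le add_left_mono norm_triangle_ineq)
      also have "\<dots> \<le> \<eta> / 2 * norm E + (\<eta> / 2 * norm E + \<delta> * norm E)"
        using t1 t2 t3 by linarith
      also have "\<dots> = (\<delta> + \<eta>) * norm E" by (simp add: algebra_simps)
      finally show "norm (\<Phi> X - Xstar) \<le> (\<delta> + \<eta>) * norm (X - Xstar)"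
        by (simp add: E_def)
    qed
  qed
  obtain \<epsilon> where \<epsilon>: "\<epsilon> > 0"
    "\<And>X. (\<forall>l. X l \<in> M) \<Longrightarrow> (\<forall>l. X (Suc l) = \<Phi> (X l)) \<Longrightarrow> (\<exists>l. norm (X l - Xstar) \<le> \<epsilon>) \<Longrightarrow>
      X \<longlonglongrightarrow> Xstar \<and>
      limsup (\<lambda>l. ereal (norm (X (Suc l) - Xstar) / norm (X l - Xstar))) \<le> ereal \<delta>"
    using locally_contracting_iteration_converges[OF \<delta>0 assms(12) contraction] by blast
  show ?thesis
  proof (intro exI[of _ \<epsilon>] conjI[OF \<epsilon>(1)] allI impI)
    fix X :: "nat \<Rightarrow> real ^ 'n ^ 'm"
    assume X0: "X 0 \<in> rank_row_sparse k s"
      and step: "\<forall>l. X (Suc l) = (T \<circ> H) (X l - adjoint A (A (X l) - y))"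
      and near: "\<exists>l. norm (X l - Xstar) \<le> \<epsilon>"
    have "X l \<in> M" for l
      using X0 step thresholding_maps_into_rank_row_sparse[OF H T]
      by (cases l) (auto simp: M_def)
    with \<epsilon>(2) step near
    show "X \<longlonglongrightarrow> Xstar \<and>
        limsup (\<lambda>l. ereal (norm (X (Suc l) - Xstar) / norm (X l - Xstar))) \<le> ereal \<delta>"
      by (simp add: \<Phi>_def)
  qed
qed

end
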